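(* Let $J$ be the monic Jacobi matrix associated with a nonrational function $F\in\mathbf N_{-\infty}$ with asymptotic coefficients $\{s_j\}_{j\ge0}$, let $s_{-1}\in\mathbb R$, let $P_j$ and $Q_j$ be the polynomials of the first and second kind, respectively, associated with the sequence $\{s_j\}_{j\ge0}$, and put $\widehat P_j(\lambda):=Q_j(\lambda)-s_{-1}P_j(\lambda)$. Then: (i) the normal indices $\mathfrak n_j$ ($j\in\mathbb N$) of the sequence $\mathfrak s=\{s_{j-1}\}_{j=0}^\infty=(s_{-1},s_0,s_1,\dots)$ can be characterized by the conditions $\widehat P_{\mathfrak n_j-1}(0)\ne0$, $j\in\mathbb N$; (ii) $J$ admits a factorization $J=\mathfrak U\mathfrak L$, where, with $\mathfrak n_0=0$ and $\mathfrak k_j=\mathfrak n_{j+1}-\mathfrak n_j$, $\mathfrak L$ and $\mathfrak U$ are block lower and block upper triangular matrices $$\mathfrak L=\begin{pmatrix}\mathfrak E_0&0&&\\ \mathfrak L_1&\mathfrak E_1&0&\\ &\mathfrak L_2&\mathfrak E_2&\ddots\\ &&\ddots&\ddots\end{pmatrix},\qquad \mathfrak U=\begin{pmatrix}\mathfrak U_0&\mathfrak D_0&&\\ 0&\mathfrak U_1&\mathfrak D_1&\\ &0&\mathfrak U_2&\ddots\\ &&\ddots&\ddots\end{pmatrix}$$ in which $\mathfrak L_j$ is the $\mathfrak k_j\times\mathfrak k_{j-1}$ matrix with lower-right entry a number $\mathfrak l_j$ and other entries $0$; $\mathfrak D_j$ is the $\mathfrak k_j\times\mathfrak k_{j+1}$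 matrix with lower-left entry $1$ and other entries $0$; $\mathfrak U_j=\mathfrak u_j$, $\mathfrak E_j=1$ if $\mathfrak k_j=1$, and $\mathfrak U_j=\begin{pmatrix}0&1\\ \mathfrak u_j&0\end{pmatrix}$, $\mathfrak E_j=\begin{pmatrix}1&0\\ \mathfrak e_j&1\end{pmatrix}$ if $\mathfrak k_j=2$. Moreover, $$\mathfrak l_j=-\frac{\widehat P_{\mathfrak n_{j+1}-1}(0)}{\widehat P_{\mathfrak n_j-1}(0)},\qquad j\in\mathbb N.$$
   Context: $\lambda\widehat\to\infty$ means that $\lambda\to\infty$ inside a sector $\varepsilon<\arg\lambda<\pi-\varepsilon$, $\varepsilon>0$. $\mathbf N$ is the class of Nevanlinna functions (analytic in $\mathbb C_+$, mapping $\mathbb C_+$ into $\mathbb C_+$). $\mathbf N_{-\infty}$ is the set of $F\in\mathbf N$ for which there are real $s_0,s_1,\dots$ with $F(\lambda)=-\frac{s_0}{\lambda}-\dots-\frac{s_{2n}}{\lambda^{2n+1}}+o(\lambda^{-2n-1})$, $\lambda\widehat\to\infty$, for every $n\in\mathbb Z_+$; equivalently $F(\lambda)=\int_{\mathbb R}\frac{d\sigma(t)}{t-\lambda}$ with a finite measure $\sigma$ with moments $s_j=\int t^jd\sigma(t)$. The polynomials of the first kind $P_j$ are the monic orthogonal polynomials of $\sigma/s_0$: $\lambda P_j=P_{j+1}+b_jP_j+c_{j-1}P_{j-1}$, $j\in\mathbb Z_+$, $P_{-1}=0$, $P_0=1$, where $b_j\in\mathbb R$, $c_j>0$ for $j\in\mathbb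 Z_+$. The polynomials of the second kind $Q_j$ are the solutions of the same recurrence with $Q_{-1}=-1$, $Q_0=0$ (with $c_{-1}=s_0$, so $c_{-1}=1$ for a probability measure); that is, $Q_j(\lambda)=\int\frac{P_j(\lambda)-P_j(t)}{\lambda-t}d\sigma(t)$ for $j\ge0$. The monic Jacobi matrix $J$ associated with $F$ is the semi-infinite tridiagonal matrix with $J_{j,j}=b_j$, $J_{j,j+1}=1$, $J_{j+1,j}=c_j$. The normal indices of a real sequence $\{\mathfrak s_j\}_{j\ge0}$ are the integers $n\ge1$ with $\det(\mathfrak s_{i+k})_{i,k=0}^{n-1}\ne0$, listed increasingly $\mathfrak n_1<\mathfrak n_2<\cdots$. In the present situation always $\mathfrak k_j\in\{1,2\}$.
   Formalization: The definition of P̂_j is corrected to Q_j + s_{-1}P_j: with the stated normalization Q_{-1} = -1, the printed minus sign makes (i) false (e.g. s_{-1} = s_0 = s_1 = 1: the 2×2 determinant is 0 but the printed P̂_1(0) = 2). *)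

theory Defs
  imports
    "HOL-Analysis.Analysis"
    "HOL-Library.Landau_Symbols"
    "HOL-Computational_Algebra.Polynomial"
    "Jordan_Normal_Form.Determinant"
begin

section \<open>Nevanlinna functions\<close>

definition nevanlinna :: "(complex \<Rightarrow> complex) \<Rightarrow> bool" where
  "nevanlinna F \<longleftrightarrow>
     F analytic_on {z. Im z > 0} \<and> (\<forall>z. Im z > 0 \<longrightarrow> Im (F z) > 0)"

definition sector_infinity :: "real \<Rightarrow> complex filter" where
  "sector_infinity \<epsilon> = inf at_infinity (principal {z. \<epsilon> < Arg z \<and> Arg z < pi - \<epsilon>})"

text \<open>\<open>F\<close> belongs to the class \<open>N\<close> with index minus infinity and has the
  asymptotic coefficients \<open>s 0, s 1, \<dots>\<close>.\<close>

definition nevanlinna_asymp :: "(complex \<Rightarrow> complex) \<Rightarrow> (nat \<Rightarrow> real) \<Rightarrow> bool" where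
  "nevanlinna_asymp F s \<longleftrightarrow>
     nevanlinna F \<and>
     (\<forall>n. \<forall>\<epsilon>>0. (\<lambda>z. F z - (- (\<Sum>k\<le>2*n. complex_of_real (s k) / z ^ (k + 1))))
        \<in> o[sector_infinity \<epsilon>](\<lambda>z. 1 / z ^ (2 * n + 1)))"

definition moment_representation ::
    "real measure \<Rightarrow> (complex \<Rightarrow> complex) \<Rightarrow> (nat \<Rightarrow> real) \<Rightarrow> bool" where
  "moment_representation \<sigma> F s \<longleftrightarrow>
     sets \<sigma> = sets borel \<and> finite_measure \<sigma> \<and>
     (\<forall>z. Im z > 0 \<longrightarrow> F z = (\<integral>t. 1 / (complex_of_real t - z) \<partial>\<sigma>)) \<and>
     (\<forall>j. integrable \<sigma> (\<lambda>t. t ^ j) \<and> s j = (\<integral>t. t ^ j \<partial>\<sigma>))"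

definition rational_on_upper_half_plane :: "(complex \<Rightarrow> complex) \<Rightarrow> bool" where
  "rational_on_upper_half_plane F \<longleftrightarrow>
     (\<exists>p q :: complex poly. \<forall>z. Im z > 0 \<longrightarrow> poly q z \<noteq> 0 \<and> F z = poly p z / poly q z)"

section \<open>Orthogonal polynomials and the Jacobi matrix\<close>

definition monic_orthogonal :: "real measure \<Rightarrow> (nat \<Rightarrow> real poly) \<Rightarrow> bool" where
  "monic_orthogonal \<sigma> P \<longleftrightarrow>
     (\<forall>n. Polynomial.degree (P n) = n \<and> lead_coeff (P n) = 1) \<and>
     (\<forall>m n. m \<noteq> n \<longrightarrow> (\<integral>t. poly (P m) t * poly (P n) t \<partial>\<sigma>) = 0)"

text \<open>\<open>\<lambda> y\<^sub>j = y\<^sub>j\<^sub>+\<^sub>1 + b\<^sub>j y\<^sub>j + c\<^sub>j\<^sub>-\<^sub>1 y\<^sub>j\<^sub>-\<^sub>1\<close> for all \<open>j \<ge> 0\<close>.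
  The data with index \<open>-1\<close> are the separate arguments \<open>cm1\<close> and \<open>ym1\<close>.\<close>

definition jacobi_recurrence ::
    "(nat \<Rightarrow> real) \<Rightarrow> (nat \<Rightarrow> real) \<Rightarrow> real \<Rightarrow> real poly \<Rightarrow> (nat \<Rightarrow> real poly) \<Rightarrow> bool" where
  "jacobi_recurrence b c cm1 ym1 y \<longleftrightarrow>
     [:0, 1:] * y 0 = y 1 + Polynomial.smult (b 0) (y 0) + Polynomial.smult cm1 ym1 \<and>
     (\<forall>j. [:0, 1:] * y (Suc j) =
            y (Suc (Suc j)) + Polynomial.smult (b (Suc j)) (y (Suc j)) + Polynomial.smult (c j) (y j))"

definition first_kind ::
    "real measure \<Rightarrow> (nat \<Rightarrow> real) \<Rightarrow> (nat \<Rightarrow> real) \<Rightarrow> (nat \<Rightarrow> real) \<Rightarrow> (nat \<Rightarrow> real poly) \<Rightarrow> bool" where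
  "first_kind \<sigma> s b c P \<longleftrightarrow>
     monic_orthogonal \<sigma> P \<and> (\<forall>j. c j > 0) \<and> P 0 = 1 \<and> jacobi_recurrence b c (s 0) 0 P"

definition second_kind ::
    "(nat \<Rightarrow> real) \<Rightarrow> (nat \<Rightarrow> real) \<Rightarrow> (nat \<Rightarrow> real) \<Rightarrow> (nat \<Rightarrow> real poly) \<Rightarrow> bool" where
  "second_kind s b c Q \<longleftrightarrow> Q 0 = 0 \<and> jacobi_recurrence b c (s 0) (-1) Q"

definition jacobi_matrix :: "(nat \<Rightarrow> real) \<Rightarrow> (nat \<Rightarrow> real) \<Rightarrow> nat \<Rightarrow> nat \<Rightarrow> real" where
  "jacobi_matrix b c i k =
     (if k = i then b i else if k = Suc i then 1 else if i = Suc k then c k else 0)"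

text \<open>Sign convention: the value on \<open>P\<^sub>j\<close> of the linear functional with moments
  \<open>s\<^sub>-\<^sub>1, s\<^sub>0, s\<^sub>1, \<dots>\<close> is \<open>s\<^sub>-\<^sub>1 P\<^sub>j(0) + \<integral> (P\<^sub>j(t) - P\<^sub>j(0)) / t d\<sigma>(t) = s\<^sub>-\<^sub>1 P\<^sub>j(0) + Q\<^sub>j(0)\<close>.
  With the normalization \<open>Q\<^sub>-\<^sub>1 = -1\<close> (so \<open>Q\<^sub>1 = s\<^sub>0\<close>) the two terms must therefore be added.
  The expression \<open>Q\<^sub>j - s\<^sub>-\<^sub>1 P\<^sub>j\<close> belongs to the opposite normalization of \<open>Q\<^sub>j\<close>.\<close>

definition P_hat :: "real \<Rightarrow> (nat \<Rightarrow> real poly) \<Rightarrow> (nat \<Rightarrow> real poly) \<Rightarrow> nat \<Rightarrow> real poly" where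
  "P_hat sm1 P Q j = Q j + Polynomial.smult sm1 (P j)"

section \<open>Normal indices\<close>

text \<open>The sequence \<open>s\<^sub>-\<^sub>1, s\<^sub>0, s\<^sub>1, \<dots>\<close>.\<close>

definition shifted_seq :: "real \<Rightarrow> (nat \<Rightarrow> real) \<Rightarrow> nat \<Rightarrow> real" where
  "shifted_seq sm1 s j = (case j of 0 \<Rightarrow> sm1 | Suc i \<Rightarrow> s i)"

definition normal_indices :: "(nat \<Rightarrow> real) \<Rightarrow> nat set" where
  "normal_indices s = {n. n \<ge> 1 \<and> Determinant.det (Matrix.mat n n (\<lambda>(i, k). s (i + k))) \<noteq> 0}"

text \<open>Meaningful when \<open>normal_indices s\<close> is infinite.\<close>

definition normal_index :: "(nat \<Rightarrow> real) \<Rightarrow> nat \<Rightarrow> nat" where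
  "normal_index s j = (case j of 0 \<Rightarrow> 0 | Suc i \<Rightarrow> enumerate (normal_indices s) i)"

definition index_gap :: "(nat \<Rightarrow> nat) \<Rightarrow> nat \<Rightarrow> nat" where
  "index_gap nn j = nn (Suc j) - nn j"

section \<open>Block matrices\<close>

text \<open>For \<open>nn\<close> strictly increasing with \<open>nn 0 = 0\<close>, the block \<open>j\<close> consists of the
  indices \<open>nn j, \<dots>, nn (Suc j) - 1\<close>; \<open>assemble nn B\<close> is the semi-infinite matrix with
  blocks \<open>B i j\<close>.\<close>

definition block_of :: "(nat \<Rightarrow> nat) \<Rightarrow> nat \<Rightarrow> nat" where
  "block_of nn r = (THE j. nn j \<le> r \<and> r < nn (Suc j))"

definition assemble :: "(nat \<Rightarrow> nat) \<Rightarrow> (nat \<Rightarrow> nat \<Rightarrow> real mat) \<Rightarrow> nat \<Rightarrow> nat \<Rightarrow> real" where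
  "assemble nn B r q =
     B (block_of nn r) (block_of nn q) $$ (r - nn (block_of nn r), q - nn (block_of nn q))"

text \<open>In the next two definitions the case \<open>k \<noteq> 1\<close> is meant for \<open>k = 2\<close>.\<close>

definition block_E :: "nat \<Rightarrow> real \<Rightarrow> real mat" where
  "block_E k e =
     (if k = 1 then mat_of_rows_list 1 [[1]] else mat_of_rows_list 2 [[1, 0], [e, 1]])"

definition block_U :: "nat \<Rightarrow> real \<Rightarrow> real mat" where
  "block_U k u =
     (if k = 1 then mat_of_rows_list 1 [[u]] else mat_of_rows_list 2 [[0, 1], [u, 0]])"

definition lower_right_entry_mat :: "nat \<Rightarrow> nat \<Rightarrow> real \<Rightarrow> real mat" where
  "lower_right_entry_mat m k x = Matrix.mat m k (\<lambda>(p, q). if p = m - 1 \<and> q = k - 1 then x else 0)"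

definition lower_left_entry_mat :: "nat \<Rightarrow> nat \<Rightarrow> real \<Rightarrow> real mat" where
  "lower_left_entry_mat m k x = Matrix.mat m k (\<lambda>(p, q). if p = m - 1 \<and> q = 0 then x else 0)"

definition L_matrix ::
    "(nat \<Rightarrow> nat) \<Rightarrow> (nat \<Rightarrow> real) \<Rightarrow> (nat \<Rightarrow> real) \<Rightarrow> nat \<Rightarrow> nat \<Rightarrow> real" where
  "L_matrix nn l e = assemble nn (\<lambda>i j.
     if i = j then block_E (index_gap nn j) (e j)
     else if i = Suc j then lower_right_entry_mat (index_gap nn i) (index_gap nn j) (l i)
     else 0\<^sub>m (index_gap nn i) (index_gap nn j))"

definition U_matrix ::
    "(nat \<Rightarrow> nat) \<Rightarrow> (nat \<Rightarrow> real) \<Rightarrow> nat \<Rightarrow> nat \<Rightarrow> real" where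
  "U_matrix nn u = assemble nn (\<lambda>i j.
     if i = j then block_U (index_gap nn j) (u j)
     else if j = Suc i then lower_left_entry_mat (index_gap nn i) (index_gap nn j) 1
     else 0\<^sub>m (index_gap nn i) (index_gap nn j))"

text \<open>Product of semi-infinite matrices with finitely supported rows of the left factor.\<close>

definition is_matrix_product ::
    "(nat \<Rightarrow> nat \<Rightarrow> real) \<Rightarrow> (nat \<Rightarrow> nat \<Rightarrow> real) \<Rightarrow> (nat \<Rightarrow> nat \<Rightarrow> real) \<Rightarrow> bool" where
  "is_matrix_product A U L \<longleftrightarrow>
     (\<forall>i. finite {m. U i m \<noteq> 0}) \<and>
     (\<forall>i k. A i k = (\<Sum>m | U i m \<noteq> 0. U i m * L m k))"

end

theory Submission
  imports Defs
begin

text \<open>Write \<open>y\<^sub>j\<close> for the value at \<open>0\<close> of \<open>P_hat sm1 P Q j\<close>, and \<open>f\<close> for the linear functional on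
  polynomials with moments \<open>s\<^sub>-\<^sub>1, s\<^sub>0, s\<^sub>1, \<dots>\<close>.

  Multiplication by the variable turns \<open>f\<close> into integration against \<open>\<sigma>\<close>, so applying \<open>f\<close> to the
  recurrence of the \<open>P\<^sub>j\<close> shows that \<open>f(P\<^sub>j)\<close> and \<open>y\<^sub>j\<close> satisfy the same recurrence, with the same initial
  values: \<open>f(P\<^sub>j) = y\<^sub>j\<close> (lemma \<open>shifted_functional_first_kind\<close>).  A vector in the kernel of the Hankel
  matrix of order \<open>n\<close> is the coefficient vector of a polynomial \<open>q\<close> of degree less than \<open>n\<close> with
  \<open>f(t\<^sup>i q) = 0\<close> for \<open>i < n\<close>.  The conditions with \<open>i \<ge> 1\<close> say that \<open>q\<close> is orthogonal to all polynomials of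
  degree less than \<open>n - 1\<close>, that is, \<open>q\<close> is a multiple of \<open>P\<^sub>n\<^sub>-\<^sub>1\<close>; the condition with \<open>i = 0\<close> then reads
  \<open>y\<^sub>n\<^sub>-\<^sub>1 = 0\<close> unless \<open>q = 0\<close>.  Hence \<open>n\<close> is a normal index if and only if \<open>y\<^sub>n\<^sub>-\<^sub>1 \<noteq> 0\<close>
  (lemma \<open>shifted_hankel_det_nonzero_iff\<close>).

  The numbers \<open>y\<^sub>j\<close> solve \<open>y\<^sub>j\<^sub>+\<^sub>2 + b\<^sub>j\<^sub>+\<^sub>1 y\<^sub>j\<^sub>+\<^sub>1 + c\<^sub>j y\<^sub>j = 0\<close> and \<open>y\<^sub>1 + b\<^sub>0 y\<^sub>0 = s\<^sub>0\<close>.  As \<open>c\<^sub>j > 0\<close> and \<open>s\<^sub>0 \<noteq> 0\<close>, no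
  two consecutive ones vanish, so that there are infinitely many normal indices and the gaps are \<open>1\<close>
  or \<open>2\<close>.  For the factorization, let a block start at row \<open>r\<close>.  If it has size \<open>2\<close>, then \<open>y\<^sub>r = 0\<close> and
  one takes \<open>e = b\<^sub>r\<close> and \<open>u = c\<^sub>r\<close>; if it has size \<open>1\<close>, one takes \<open>u = - c\<^sub>r\<^sub>-\<^sub>1 y\<^sub>r\<^sub>-\<^sub>1 / y\<^sub>r\<close>, or
  \<open>u = s\<^sub>0 / y\<^sub>0\<close> when \<open>r = 0\<close>.  With \<open>l\<close> as in the theorem, the equation \<open>J = U L\<close> is then, entry by
  entry, the recurrence for \<open>y\<close> (lemma \<open>jacobi_factorization\<close>).\<close>

section \<open>The linear functional with prescribed moments\<close>

text \<open>The linear functional on polynomials whose value at \<open>t\<^sup>i\<close> is \<open>s i\<close>.\<close>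

definition moment_functional :: "(nat \<Rightarrow> real) \<Rightarrow> real poly \<Rightarrow> real" where
  "moment_functional s p = (\<Sum>i\<le>Polynomial.degree p. Polynomial.coeff p i * s i)"

lemma moment_functional_bound:
  assumes "Polynomial.degree p \<le> n"
  shows "moment_functional s p = (\<Sum>i\<le>n. Polynomial.coeff p i * s i)"
  unfolding moment_functional_def
  by (rule sum.mono_neutral_left) (use assms in \<open>auto simp: coeff_eq_0\<close>)

lemma moment_functional_0 [simp]: "moment_functional s 0 = 0"
  by (simp add: moment_functional_def)

lemma moment_functional_1 [simp]: "moment_functional s 1 = s 0"
  by (simp add: moment_functional_def)

lemma moment_functional_add:
  "moment_functional s (p + q) = moment_functional s p + moment_functional s q"
proof -
  define n where "n = max (Polynomial.degree p) (Polynomial.degree q)"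
  have "Polynomial.degree p \<le> n" "Polynomial.degree q \<le> n" "Polynomial.degree (p + q) \<le> n"
    by (auto simp: n_def degree_add_le_max)
  then show ?thesis
    by (simp add: moment_functional_bound[where n = n] sum.distrib distrib_right)
qed

lemma moment_functional_smult:
  "moment_functional s (Polynomial.smult a p) = a * moment_functional s p"
  by (simp add: moment_functional_bound[where n = "Polynomial.degree p"] sum_distrib_left mult.assoc)

lemma moment_functional_pCons_0:
  "moment_functional s (pCons 0 p) = moment_functional (\<lambda>i. s (Suc i)) p"
proof -
  have "moment_functional s (pCons 0 p) =
      (\<Sum>i\<le>Suc (Polynomial.degree p). Polynomial.coeff (pCons 0 p) i * s i)"
    by (rule moment_functional_bound) (simp add: degree_pCons_le)
  also have "\<dots> = (\<Sum>i\<le>Polynomial.degree p. Polynomial.coeff p i * s (Suc i))"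
    by (subst sum.atMost_Suc_shift) simp
  finally show ?thesis
    by (simp add: moment_functional_def)
qed

lemma moment_functional_monom_mult:
  assumes "Polynomial.degree q \<le> m"
  shows "moment_functional s (Polynomial.monom 1 i * q) =
    (\<Sum>k\<le>m. Polynomial.coeff q k * s (i + k))"
proof (induction i arbitrary: s)
  case 0
  then show ?case
    using assms by (simp add: moment_functional_bound monom_0 flip: one_pCons)
next
  case (Suc i)
  have "Polynomial.monom 1 (Suc i) * q = pCons 0 (Polynomial.monom 1 i * q)"
    by (simp add: monom_Suc)
  then show ?case
    using Suc by (simp add: moment_functional_pCons_0)
qed

lemma moment_functional_integral:
  assumes "\<And>j. integrable \<sigma> (\<lambda>t. t ^ j)" and "\<And>j. s j = (\<integral>t. t ^ j \<partial>\<sigma>)"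
  shows "moment_functional s p = (\<integral>t. poly p t \<partial>\<sigma>)"
  using assms by (simp add: moment_functional_def poly_altdef)

section \<open>Hankel determinants and orthogonal polynomials\<close>

text \<open>Monic polynomials, one of each degree, that are orthogonal with respect to the functional with
  moments \<open>s\<close>.  The squared norms are required only to be nonzero, not positive.\<close>

locale monic_orthogonal_system =
  fixes s :: "nat \<Rightarrow> real" and P :: "nat \<Rightarrow> real poly"
  assumes degree_P: "Polynomial.degree (P n) = n"
    and lead_P: "lead_coeff (P n) = 1"
    and orthogonal: "m \<noteq> n \<Longrightarrow> moment_functional s (P m * P n) = 0"
    and norm_nonzero: "moment_functional s (P n * P n) \<noteq> 0"
begin

lemma coeff_P_self: "Polynomial.coeff (P n) n = 1"
  using lead_P[of n] by (simp add: degree_P)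

lemma split_leading_term:
  assumes "Polynomial.degree p \<le> m"
  obtains r where "p = Polynomial.smult (Polynomial.coeff p m) (P m) + r"
    and "r = 0 \<or> Polynomial.degree r < m"
proof -
  define r where "r = p - Polynomial.smult (Polynomial.coeff p m) (P m)"
  have "Polynomial.degree r \<le> m"
    unfolding r_def using assms degree_P[of m] by (intro degree_diff_le) (auto simp: degree_smult_le)
  moreover have "Polynomial.coeff r m = 0"
    by (simp add: r_def coeff_P_self)
  ultimately have "r = 0 \<or> Polynomial.degree r < m"
    by (metis le_neq_implies_less leading_coeff_0_iff)
  then show ?thesis
    using that[of r] by (simp add: r_def)
qed

lemma orthogonal_lower_degree:
  "p = 0 \<or> Polynomial.degree p < m \<Longrightarrow> moment_functional s (p * P m) = 0"
proof (induction "Polynomial.degree p" arbitrary: p rule: less_induct)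
  case less
  show ?case
  proof (cases "p = 0")
    case False
    then have d: "Polynomial.degree p < m" using less.prems by simp
    obtain r where r: "p = Polynomial.smult (lead_coeff p) (P (Polynomial.degree p)) + r"
      "r = 0 \<or> Polynomial.degree r < Polynomial.degree p"
      using split_leading_term[OF order_refl] by blast
    have "moment_functional s (r * P m) = 0"
      using less.hyps[of r] r(2) d by auto
    moreover have "p * P m =
        Polynomial.smult (lead_coeff p) (P (Polynomial.degree p) * P m) + r * P m"
      using arg_cong[OF r(1), of "\<lambda>x. x * P m"] by (simp add: distrib_right)
    ultimately show ?thesis
      using orthogonal[of "Polynomial.degree p" m] d
      by (simp add: moment_functional_add moment_functional_smult)
  qed simp
qed

lemma orthogonal_monom: "i < m \<Longrightarrow> moment_functional s (Polynomial.monom 1 i * P m) = 0"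
  by (rule orthogonal_lower_degree) (simp add: degree_monom_eq)

lemma orthogonal_all_lower:
  assumes "\<And>i. i < m \<Longrightarrow> moment_functional s (Polynomial.monom 1 i * q) = 0"
    and "Polynomial.degree p < m"
  shows "moment_functional s (p * q) = 0"
proof -
  have sum: "moment_functional s (\<Sum>i\<in>A. f i) = (\<Sum>i\<in>A. moment_functional s (f i))"
    if "finite A" for A and f :: "nat \<Rightarrow> real poly"
    using that by induction (auto simp: moment_functional_add)
  have "p * q = (\<Sum>i\<le>Polynomial.degree p.
      Polynomial.smult (Polynomial.coeff p i) (Polynomial.monom 1 i * q))"
    by (subst (1) poly_as_sum_of_monoms[of p, symmetric])
       (simp add: sum_distrib_right smult_monom flip: mult_smult_left)
  also have "moment_functional s \<dots> = 0"
    using assms by (subst sum) (auto simp: moment_functional_smult intro!: sum.neutral)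
  finally show ?thesis .
qed

text \<open>If the part of \<open>q\<close> below degree \<open>m\<close> were a nonzero \<open>r\<close> of degree \<open>d < m\<close>, then pairing \<open>q\<close> with
  \<open>P d\<close> would give the leading coefficient of \<open>r\<close> times the nonzero squared norm of \<open>P d\<close>.\<close>

lemma orthogonal_unique:
  assumes "Polynomial.degree q \<le> m"
    and "\<And>i. i < m \<Longrightarrow> moment_functional s (Polynomial.monom 1 i * q) = 0"
  shows "q = Polynomial.smult (Polynomial.coeff q m) (P m)"
proof -
  obtain r where r: "q = Polynomial.smult (Polynomial.coeff q m) (P m) + r"
    "r = 0 \<or> Polynomial.degree r < m"
    using split_leading_term[OF assms(1)] by blast
  have "r = 0"
  proof (rule ccontr)
    assume nz: "r \<noteq> 0"
    define d where "d = Polynomial.degree r"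
    have d: "d < m" using nz r(2) by (simp add: d_def)
    obtain r' where r': "r = Polynomial.smult (lead_coeff r) (P d) + r'"
      "r' = 0 \<or> Polynomial.degree r' < d"
      using split_leading_term[of r d] by (auto simp: d_def)
    have "moment_functional s (P d * q) = 0"
      by (rule orthogonal_all_lower[OF assms(2)]) (use d in \<open>auto simp: degree_P\<close>)
    moreover have "P d * q = Polynomial.smult (Polynomial.coeff q m) (P d * P m)
        + Polynomial.smult (lead_coeff r) (P d * P d) + r' * P d"
    proof -
      have "P d * q = P d * (Polynomial.smult (Polynomial.coeff q m) (P m)
          + (Polynomial.smult (lead_coeff r) (P d) + r'))"
        using r(1) r'(1) by metis
      then show ?thesis by (simp add: algebra_simps)
    qed
    ultimately have "lead_coeff r * moment_functional s (P d * P d) = 0"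
      using orthogonal[of d m] orthogonal_lower_degree[of r' d] d r'(2)
      by (simp add: moment_functional_add moment_functional_smult)
    then show False using nz norm_nonzero[of d] by simp
  qed
  then show ?thesis using r(1) by simp
qed

lemma shifted_functional_pCons:
  "moment_functional (shifted_seq a s) (pCons 0 p) = moment_functional s p"
  by (simp add: moment_functional_pCons_0 shifted_seq_def)

text \<open>A vector \<open>v\<close> in the kernel is identified with the polynomial with coefficients \<open>v\<close>; row \<open>i\<close> of the
  matrix evaluates the functional of the shifted sequence at \<open>t\<^sup>i\<close> times this polynomial.\<close>

lemma shifted_hankel_det_nonzero_iff:
  "Determinant.det (Matrix.mat (Suc m) (Suc m) (\<lambda>(i, k). shifted_seq a s (i + k))) \<noteq> 0
    \<longleftrightarrow> moment_functional (shifted_seq a s) (P m) \<noteq> 0"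
proof -
  let ?s = "shifted_seq a s"
  define A where "A = Matrix.mat (Suc m) (Suc m) (\<lambda>(i, k). ?s (i + k))"
  have A: "A \<in> carrier_mat (Suc m) (Suc m)" by (simp add: A_def)
  have mult: "vec_index (A *\<^sub>v v) i = moment_functional ?s (Polynomial.monom 1 i * q)"
    if "v \<in> carrier_vec (Suc m)" "i < Suc m" "Polynomial.degree q \<le> m"
      "\<And>k. k < Suc m \<Longrightarrow> vec_index v k = Polynomial.coeff q k" for v i q
    using that
    by (subst moment_functional_monom_mult[of q m])
       (auto simp: A_def scalar_prod_def mult.commute atLeast0LessThan lessThan_Suc_atMost intro!: sum.cong)
  have shift: "moment_functional ?s (Polynomial.monom 1 (Suc i) * q)
      = moment_functional s (Polynomial.monom 1 i * q)" for i q
    by (simp add: monom_Suc shifted_functional_pCons)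
  have m0: "Polynomial.monom (1::real) 0 = 1" by (simp add: monom_0 one_pCons)
  have "Determinant.det A = 0 \<longleftrightarrow> moment_functional ?s (P m) = 0"
  proof
    assume "Determinant.det A = 0"
    then obtain v where v: "v \<in> carrier_vec (Suc m)" "v \<noteq> 0\<^sub>v (Suc m)" "A *\<^sub>v v = 0\<^sub>v (Suc m)"
      using det_0_iff_vec_prod_zero[OF A] by auto
    define q where "q = (\<Sum>k\<le>m. Polynomial.monom (vec_index v k) k)"
    have coeff_q: "Polynomial.coeff q k = (if k \<le> m then vec_index v k else 0)" for k
      by (simp add: q_def coeff_sum)
    have deg_q: "Polynomial.degree q \<le> m"
      by (rule degree_le) (simp add: coeff_q)
    have zero: "moment_functional ?s (Polynomial.monom 1 i * q) = 0" if "i < Suc m" for i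
      using mult[OF v(1) that deg_q] v(3) that by (simp add: coeff_q)
    have q: "q = Polynomial.smult (Polynomial.coeff q m) (P m)"
      using deg_q by (rule orthogonal_unique) (use zero shift in \<open>metis Suc_less_eq\<close>)
    have "moment_functional ?s q = 0" using zero[of 0] by (simp add: m0)
    then have "Polynomial.coeff q m * moment_functional ?s (P m) = 0"
      by (metis q moment_functional_smult)
    moreover have "Polynomial.coeff q m \<noteq> 0"
    proof
      assume "Polynomial.coeff q m = 0"
      then have "q = 0" using q by (metis smult_0_left)
      then have "vec_index v k = 0" if "k < Suc m" for k using coeff_q[of k] that by simp
      then have "v = 0\<^sub>v (Suc m)" using v(1) by (intro eq_vecI) auto
      then show False using v(2) by simp
    qed
    ultimately show "moment_functional ?s (P m) = 0" by simp
  next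
    assume y: "moment_functional ?s (P m) = 0"
    define v where "v = Matrix.vec (Suc m) (Polynomial.coeff (P m))"
    have v: "v \<in> carrier_vec (Suc m)" by (simp add: v_def)
    have "vec_index v m = 1" by (simp add: v_def coeff_P_self)
    then have nz: "v \<noteq> 0\<^sub>v (Suc m)" by auto
    have "vec_index (A *\<^sub>v v) i = 0" if i: "i < Suc m" for i
    proof -
      have "vec_index (A *\<^sub>v v) i = moment_functional ?s (Polynomial.monom 1 i * P m)"
        by (rule mult[OF v i]) (auto simp: degree_P v_def)
      also have "\<dots> = 0"
        using y i by (cases i) (auto simp: m0 shift orthogonal_monom)
      finally show ?thesis .
    qed
    then have "A *\<^sub>v v = 0\<^sub>v (Suc m)" using A by (intro eq_vecI) auto
    then show "Determinant.det A = 0"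
      using det_0_iff_vec_prod_zero[OF A] v nz by auto
  qed
  then show ?thesis by (simp add: A_def)
qed

end

section \<open>Entries of the block triangular factors\<close>

text \<open>A partition of the row indices into consecutive blocks of size \<open>1\<close> or \<open>2\<close>, the block \<open>j\<close> starting at
  \<open>nn j\<close>.\<close>

locale block_partition =
  fixes nn :: "nat \<Rightarrow> nat"
  assumes start: "nn 0 = 0"
    and gap: "index_gap nn j \<in> {1, 2}"
begin

lemma nn_Suc: "nn (Suc j) = nn j + index_gap nn j"
  using gap[of j] by (auto simp: index_gap_def)

lemma strict_mono_nn: "strict_mono nn"
proof -
  have "nn k < nn (Suc k)" for k
    using nn_Suc[of k] gap[of k] by auto
  then show ?thesis by (simp add: strict_mono_Suc_iff)
qed

lemma nn_le_iff: "nn i \<le> nn j \<longleftrightarrow> i \<le> j"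
  using strict_mono_nn by (simp add: strict_mono_less_eq)

lemma block_exists: obtains j where "nn j \<le> r" "r < nn (Suc j)"
proof -
  have "\<exists>j. nn j \<le> r \<and> r < nn (Suc j)"
  proof (induction r)
    case 0
    then show ?case using start nn_Suc[of 0] gap[of 0] by (intro exI[of _ 0]) auto
  next
    case (Suc r)
    then obtain j where j: "nn j \<le> r" "r < nn (Suc j)" by blast
    show ?case
    proof (cases "Suc r < nn (Suc j)")
      case True
      then show ?thesis using j by (intro exI[of _ j]) auto
    next
      case False
      then show ?thesis using j nn_Suc[of "Suc j"] gap[of "Suc j"]
        by (intro exI[of _ "Suc j"]) auto
    qed
  qed
  then show ?thesis using that by blast
qed

lemma block_unique: "nn i \<le> r \<Longrightarrow> r < nn (Suc i) \<Longrightarrow> nn j \<le> r \<Longrightarrow> r < nn (Suc j) \<Longrightarrow> i = j"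
  using nn_le_iff[of "Suc i" j] nn_le_iff[of "Suc j" i] by linarith

lemma block_of_eq: "nn j \<le> r \<Longrightarrow> r < nn (Suc j) \<Longrightarrow> block_of nn r = j"
  unfolding block_of_def by (rule the_equality) (auto intro: block_unique)

text \<open>The position of the index \<open>q\<close> inside its block \<open>i\<close>: alone, first of two, or second of two.\<close>

lemma block_cases:
  assumes "nn i \<le> q" "q < nn (Suc i)"
  obtains (single) "q = nn i" "index_gap nn i = 1" "nn (Suc i) = Suc q"
  | (first) "q = nn i" "index_gap nn i = 2" "nn (Suc i) = Suc (Suc q)"
  | (second) "q = Suc (nn i)" "index_gap nn i = 2" "nn (Suc i) = Suc q"
proof -
  have "nn (Suc i) = nn i + 1 \<and> index_gap nn i = 1 \<or> nn (Suc i) = nn i + 2 \<and> index_gap nn i = 2"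
    using nn_Suc[of i] gap[of i] by auto
  then have "q = nn i \<and> index_gap nn i = 1 \<and> nn (Suc i) = Suc q
    \<or> q = nn i \<and> index_gap nn i = 2 \<and> nn (Suc i) = Suc (Suc q)
    \<or> q = Suc (nn i) \<and> index_gap nn i = 2 \<and> nn (Suc i) = Suc q"
    using assms by auto
  then show ?thesis using that by blast
qed

text \<open>The relative position of the blocks of \<open>r\<close> and \<open>q\<close>, with the inequalities between the two
  indices that decide which entries of the factors at \<open>(r, q)\<close> are \<open>0\<close>.\<close>

lemma block_position_cases:
  assumes "nn j \<le> r" "r < nn (Suc j)" "nn i \<le> q" "q < nn (Suc i)"
  obtains (same) "i = j" | (next_block) "i = Suc j" "r < nn i" "Suc r \<noteq> nn (Suc j) \<longrightarrow> Suc r < q"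
  | (prev_block) "j = Suc i" "q < nn j"
  | (far_right) "Suc j < i" "Suc r < q" | (far_left) "Suc i < j" "Suc q < nn j"
proof -
  have lt: "nn (Suc k) < nn (Suc (Suc k))" for k
    using strict_mono_nn by (simp add: strict_mono_less)
  have "i < j \<Longrightarrow> nn (Suc i) \<le> nn j" "Suc j < i \<Longrightarrow> nn (Suc (Suc j)) \<le> nn i"
    "Suc i < j \<Longrightarrow> nn (Suc (Suc i)) \<le> nn j"
    by (simp_all add: nn_le_iff)
  then consider "i = j" | "i = Suc j" | "j = Suc i" | "Suc j < i" "nn (Suc (Suc j)) \<le> nn i"
    | "Suc i < j" "nn (Suc (Suc i)) \<le> nn j" by linarith
  then show ?thesis
    using assms lt[of i] lt[of j] that by cases auto
qed

text \<open>The diagonal blocks of \<open>U\<close> and the blocks next to them together have a \<open>1\<close> at every position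
  \<open>(r, r + 1)\<close>; the number \<open>u j\<close> stands in the last row and the first column of block \<open>j\<close>, for either
  block size.\<close>

lemma U_matrix_entry:
  assumes r: "nn j \<le> r" "r < nn (Suc j)"
  shows "U_matrix nn u r q =
    (if q = Suc r then 1
     else if q = nn j \<and> Suc r = nn (Suc j) then u j else 0)"
proof -
  obtain i where q: "nn i \<le> q" "q < nn (Suc i)" by (rule block_exists)
  have "U_matrix nn u r q =
    (if j = i then block_U (index_gap nn i) (u i)
     else if i = Suc j then lower_left_entry_mat (index_gap nn j) (index_gap nn i) 1
     else 0\<^sub>m (index_gap nn j) (index_gap nn i)) $$ (r - nn j, q - nn i)"
    by (simp add: U_matrix_def assemble_def block_of_eq[OF r] block_of_eq[OF q])
  then show ?thesis
    by (cases rule: block_position_cases[OF r q]; cases rule: block_cases[OF r];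
        cases rule: block_cases[OF q])
       (auto simp: block_U_def lower_left_entry_mat_def mat_of_rows_list_def)
qed

lemma L_matrix_entry:
  assumes r: "nn j \<le> r" "r < nn (Suc j)"
  shows "L_matrix nn l e r q =
    (if q = r then 1
     else if r = Suc (nn j) \<and> q = nn j then e j
     else if Suc r = nn (Suc j) \<and> Suc q = nn j then l j else 0)"
proof -
  obtain i where q: "nn i \<le> q" "q < nn (Suc i)" by (rule block_exists)
  have "L_matrix nn l e r q =
    (if j = i then block_E (index_gap nn i) (e i)
     else if j = Suc i then lower_right_entry_mat (index_gap nn j) (index_gap nn i) (l j)
     else 0\<^sub>m (index_gap nn j) (index_gap nn i)) $$ (r - nn j, q - nn i)"
    by (simp add: L_matrix_def assemble_def block_of_eq[OF r] block_of_eq[OF q])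
  then show ?thesis
    by (cases rule: block_position_cases[OF r q]; cases rule: block_cases[OF r];
        cases rule: block_cases[OF q])
       (auto simp: block_E_def lower_right_entry_mat_def mat_of_rows_list_def)
qed

text \<open>The equation \<open>J = U L\<close> in terms of the scalar sequence \<open>y\<close>.  The hypotheses say that \<open>y\<close> solves
  the recurrence of \<open>J\<close> at the point \<open>0\<close> (with the inhomogeneous term \<open>s0\<close> in row \<open>0\<close>), that it does not
  vanish at the last row of any block, and that it vanishes at the first row of each block of size \<open>2\<close>.
  Since row \<open>i\<close> of \<open>U\<close> is supported on the first column of its block and on column \<open>i + 1\<close>, each entry
  of the product involves at most two rows of \<open>L\<close>.\<close>

lemma jacobi_factorization:
  fixes y b c :: "nat \<Rightarrow> real"
  assumes y_1: "y 1 + b 0 * y 0 = s0"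
    and y_rec: "\<And>r. y (Suc (Suc r)) + b (Suc r) * y (Suc r) + c r * y r = 0"
    and last_nonzero: "\<And>r j. Suc r = nn (Suc j) \<Longrightarrow> y r \<noteq> 0"
    and first_zero: "\<And>j. Suc (Suc (nn j)) = nn (Suc j) \<Longrightarrow> y (nn j) = 0"
    and l_def: "\<And>j. l j = - y (nn (Suc j) - 1) / y (nn j - 1)"
    and e_def: "\<And>j. e j = b (nn j)"
    and u_def: "\<And>j. u j = (if index_gap nn j = 2 then c (nn j)
       else if j = 0 then s0 / y 0 else - c (nn j - 1) * y (nn j - 1) / y (nn j))"
  shows "is_matrix_product (jacobi_matrix b c) (U_matrix nn u) (L_matrix nn l e)"
  unfolding is_matrix_product_def
proof (intro conjI allI)
  fix i
  obtain j where j: "nn j \<le> i" "i < nn (Suc j)" by (rule block_exists)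
  have supp: "{m. U_matrix nn u i m \<noteq> 0} \<subseteq> {nn j, Suc i}"
    by (auto simp: U_matrix_entry[OF j])
  then show "finite {m. U_matrix nn u i m \<noteq> 0}"
    by (rule finite_subset) simp
  fix k
  have lt: "nn j < nn (Suc j)" "nn (Suc j) < nn (Suc (Suc j))"
    using strict_mono_nn by (simp_all add: strict_mono_less)
  have "(\<Sum>m | U_matrix nn u i m \<noteq> 0. U_matrix nn u i m * L_matrix nn l e m k)
      = (\<Sum>m\<in>{nn j, Suc i}. U_matrix nn u i m * L_matrix nn l e m k)"
    by (rule sum.mono_neutral_left) (use supp in auto)
  also have "\<dots> = (if Suc i = nn (Suc j) then u j * L_matrix nn l e (nn j) k else 0)
      + L_matrix nn l e (Suc i) k"
    using j by (auto simp: U_matrix_entry[OF j])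
  finally have product: "(\<Sum>m | U_matrix nn u i m \<noteq> 0. U_matrix nn u i m * L_matrix nn l e m k)
      = (if Suc i = nn (Suc j) then u j * L_matrix nn l e (nn j) k else 0)
      + L_matrix nn l e (Suc i) k" .
  have L_first: "L_matrix nn l e (nn j) k = (if k = nn j then 1
      else if Suc (nn j) = nn (Suc j) \<and> Suc k = nn j then l j else 0)"
    using lt by (simp add: L_matrix_entry[of j])
  have previous: "j \<noteq> 0 \<and> y q \<noteq> 0" if "Suc q = nn j" for q
    using that start last_nonzero[of q "j - 1"] by (cases j) auto
  \<comment> \<open>If the next block has size \<open>2\<close>, its first row in \<open>L\<close> has no subdiagonal entry; this agrees with
    the quotient below because then \<open>y (Suc i) = 0\<close>.\<close>
  have next_row: "L_matrix nn l e (Suc i) k =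
      (if k = Suc i then 1 else if k = i then - y (Suc i) / y i else 0)"
    if "Suc i = nn (Suc j)"
  proof -
    have Suc_last: "nn (Suc j) = Suc i" using that by simp
    consider "nn (Suc (Suc j)) = Suc (Suc i)" | "nn (Suc (Suc j)) = Suc (Suc (Suc i))"
      using nn_Suc[of "Suc j"] gap[of "Suc j"] Suc_last by auto
    then have "(if Suc (Suc i) = nn (Suc (Suc j)) then l (Suc j) else 0) = - y (Suc i) / y i"
    proof cases
      case 1
      then show ?thesis using l_def[of "Suc j"] by (simp add: Suc_last)
    next
      case 2
      then show ?thesis using first_zero[of "Suc j"] Suc_last by simp
    qed
    then show ?thesis
      using L_matrix_entry[of "Suc j" "Suc i" l e k] lt that by auto
  qed
  show "jacobi_matrix b c i k =
      (\<Sum>m | U_matrix nn u i m \<noteq> 0. U_matrix nn u i m * L_matrix nn l e m k)"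
    unfolding product
  proof (cases rule: block_cases[OF j, case_names single first second])
    case single
    have y_i: "y i \<noteq> 0" using last_nonzero[of i j] single by simp
    show "jacobi_matrix b c i k = (if Suc i = nn (Suc j) then u j * L_matrix nn l e (nn j) k else 0)
      + L_matrix nn l e (Suc i) k"
    proof (cases i)
      case 0
      then have "j = 0" using single start nn_le_iff[of j 0] by simp
      moreover have "b 0 = s0 / y 0 - y 1 / y 0"
        using y_1 y_i 0 by (simp add: field_simps)
      ultimately show ?thesis
        using 0 single next_row L_first
        by (simp add: jacobi_matrix_def u_def)
    next
      case (Suc q)
      then have q: "j \<noteq> 0" "y q \<noteq> 0" using previous[of q] single by auto
      have u: "u j = - c q * y q / y i" and l: "l j = - y i / y q"
        using q Suc single(2) single(3) single(1)[symmetric] by (simp_all add: u_def l_def)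
      have "b i = u j - y (Suc i) / y i"
        using y_rec[of q] y_i Suc by (simp add: u field_simps)
      moreover have "u j * l j = c q"
        using y_i q by (simp add: u l)
      ultimately show ?thesis
        using single next_row L_first Suc by (auto simp: jacobi_matrix_def)
    qed
  next
    case first
    have "l j = c q" if q: "Suc q = nn j" for q
    proof -
      have nn: "nn j = Suc q" "nn (Suc j) = Suc (Suc (Suc q))" using first q by simp_all
      then have "y (Suc (Suc q)) = - c q * y q"
        using y_rec[of q] first_zero[of j] by simp
      then show ?thesis using previous[OF q] l_def[of j] by (simp add: nn)
    qed
    then show "jacobi_matrix b c i k = (if Suc i = nn (Suc j) then u j * L_matrix nn l e (nn j) k else 0)
      + L_matrix nn l e (Suc i) k"
      using first L_matrix_entry[of j "Suc i" l e k] by (auto simp: jacobi_matrix_def e_def)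
  next
    case second
    have "b i = - y (Suc i) / y i"
      using last_nonzero[of i j] first_zero[of j] y_rec[of "nn j"] second
      by (simp add: field_simps)
    then show "jacobi_matrix b c i k = (if Suc i = nn (Suc j) then u j * L_matrix nn l e (nn j) k else 0)
      + L_matrix nn l e (Suc i) k"
      using second next_row L_first by (auto simp: jacobi_matrix_def u_def)
  qed
qed

end

section \<open>Moments, orthogonal polynomials and normal indices\<close>

lemma total_mass_nonzero:
  assumes "nevanlinna F" and "moment_representation \<sigma> F s"
  shows "s 0 \<noteq> 0"
proof
  assume "s 0 = 0"
  have fin: "finite_measure \<sigma>" and F: "F \<i> = (\<integral>t. 1 / (complex_of_real t - \<i>) \<partial>\<sigma>)"
    and "s 0 = (\<integral>t. t ^ 0 \<partial>\<sigma>)"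
    using assms(2) by (simp_all add: moment_representation_def)
  then have "measure \<sigma> (space \<sigma>) = 0" using \<open>s 0 = 0\<close> by simp
  then have "emeasure \<sigma> (space \<sigma>) = 0"
    using finite_measure.emeasure_eq_measure[OF fin] by simp
  then have "AE t in \<sigma>. 1 / (complex_of_real t - \<i>) = 0"
    by (rule emeasure_0_AE)
  then have "F \<i> = 0" unfolding F by (rule integral_eq_zero_AE)
  moreover have "Im (F \<i>) > 0"
    using assms(1) by (auto simp: nevanlinna_def)
  ultimately show False by simp
qed

lemma jacobi_recurrence_0:
  "jacobi_recurrence b c cm1 ym1 y \<Longrightarrow>
    pCons 0 (y 0) = y 1 + Polynomial.smult (b 0) (y 0) + Polynomial.smult cm1 ym1"
  by (simp add: jacobi_recurrence_def)

lemma jacobi_recurrence_Suc: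
  "jacobi_recurrence b c cm1 ym1 y \<Longrightarrow>
    pCons 0 (y (Suc j)) =
      y (Suc (Suc j)) + Polynomial.smult (b (Suc j)) (y (Suc j)) + Polynomial.smult (c j) (y j)"
  by (simp add: jacobi_recurrence_def)

text \<open>The norms do not vanish: evaluating the functional at \<open>\<lambda> P\<^sub>n P\<^sub>n\<^sub>+\<^sub>1\<close> by means of the recurrence for
  \<open>\<lambda> P\<^sub>n\<close> and of the one for \<open>\<lambda> P\<^sub>n\<^sub>+\<^sub>1\<close> shows that the squared norm of \<open>P\<^sub>n\<^sub>+\<^sub>1\<close> is \<open>c\<^sub>n\<close> times that of \<open>P\<^sub>n\<close>.\<close>

lemma first_kind_orthogonal_system:
  assumes moments: "moment_representation \<sigma> F s" and first: "first_kind \<sigma> s b c P"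
    and s_0: "s 0 \<noteq> 0"
  shows "monic_orthogonal_system s P"
proof
  have mf: "moment_functional s p = (\<integral>t. poly p t \<partial>\<sigma>)" for p
    using moments by (intro moment_functional_integral) (auto simp: moment_representation_def)
  have rec: "jacobi_recurrence b c (s 0) 0 P" and c: "c j > 0" and P_0: "P 0 = 1"
    and mon: "monic_orthogonal \<sigma> P" for j
    using first by (auto simp: first_kind_def)
  show "Polynomial.degree (P n) = n" "lead_coeff (P n) = 1" for n
    using mon unfolding monic_orthogonal_def by blast+
  show orth: "moment_functional s (P m * P n) = 0" if "m \<noteq> n" for m n
    using mon that by (simp add: mf monic_orthogonal_def)
  have norm_Suc: "moment_functional s (P (Suc n) * P (Suc n)) = c n * moment_functional s (P n * P n)" for n
  proof -
    obtain p where p: "pCons 0 (P n) = P (Suc n) + Polynomial.smult (b n) (P n) + p"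
      "moment_functional s (p * P (Suc n)) = 0"
    proof (cases n)
      case 0
      then show ?thesis using jacobi_recurrence_0[OF rec] that[of 0] by simp
    next
      case (Suc k)
      then show ?thesis
        using jacobi_recurrence_Suc[OF rec, of k] orth[of k "Suc n"]
          that[of "Polynomial.smult (c k) (P k)"]
        by (simp add: moment_functional_smult)
    qed
    have "moment_functional s (pCons 0 (P n) * P (Suc n)) = moment_functional s (P (Suc n) * P (Suc n))"
      unfolding p(1) using orth[of n "Suc n"] p(2)
      by (simp add: distrib_right moment_functional_add moment_functional_smult)
    moreover have "moment_functional s (pCons 0 (P (Suc n)) * P n) = c n * moment_functional s (P n * P n)"
      unfolding jacobi_recurrence_Suc[OF rec] using orth[of "Suc n" n] orth[of "Suc (Suc n)" n]
      by (simp add: distrib_right moment_functional_add moment_functional_smult)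
    moreover have "pCons 0 (P n) * P (Suc n) = pCons 0 (P (Suc n)) * P n"
      by (simp add: mult.commute)
    ultimately show ?thesis by metis
  qed
  show "moment_functional s (P n * P n) \<noteq> 0" for n
  proof (induction n)
    case 0
    then show ?case using s_0 by (simp add: P_0)
  next
    case (Suc n)
    then show ?case using c[of n] by (simp add: norm_Suc)
  qed
qed

lemma P_hat_recurrence:
  fixes a :: real and y :: "nat \<Rightarrow> real"
  assumes first: "first_kind \<sigma> s b c P" and second: "second_kind s b c Q"
  defines "y \<equiv> \<lambda>j. poly (P_hat a P Q j) 0"
  shows "y 0 = a" and "y 1 + b 0 * y 0 = s 0"
    and "y (Suc (Suc j)) + b (Suc j) * y (Suc j) + c j * y j = 0"
proof -
  have P: "P 0 = 1" "jacobi_recurrence b c (s 0) 0 P"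
    and Q: "Q 0 = 0" "jacobi_recurrence b c (s 0) (-1) Q"
    using first second by (auto simp: first_kind_def second_kind_def)
  show "y 0 = a" by (simp add: y_def P_hat_def P Q)
  have "poly (P 1) 0 + b 0 = 0" "poly (Q 1) 0 = s 0"
    using arg_cong[OF jacobi_recurrence_0[OF P(2)], of "\<lambda>p. poly p 0"]
      arg_cong[OF jacobi_recurrence_0[OF Q(2)], of "\<lambda>p. poly p 0"]
    by (simp_all add: P Q)
  moreover have "y 1 + b 0 * y 0 = poly (Q 1) 0 + a * (poly (P 1) 0 + b 0)"
    by (simp add: y_def P_hat_def P Q algebra_simps)
  ultimately show "y 1 + b 0 * y 0 = s 0" by simp
  have "poly (P (Suc (Suc j))) 0 + b (Suc j) * poly (P (Suc j)) 0 + c j * poly (P j) 0 = 0"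
    and "poly (Q (Suc (Suc j))) 0 + b (Suc j) * poly (Q (Suc j)) 0 + c j * poly (Q j) 0 = 0"
    using arg_cong[OF jacobi_recurrence_Suc[OF P(2), of j], of "\<lambda>p. poly p 0"]
      arg_cong[OF jacobi_recurrence_Suc[OF Q(2), of j], of "\<lambda>p. poly p 0"] by simp_all
  moreover have "y (Suc (Suc j)) + b (Suc j) * y (Suc j) + c j * y j =
      (poly (Q (Suc (Suc j))) 0 + b (Suc j) * poly (Q (Suc j)) 0 + c j * poly (Q j) 0)
      + a * (poly (P (Suc (Suc j))) 0 + b (Suc j) * poly (P (Suc j)) 0 + c j * poly (P j) 0)"
    by (simp add: y_def P_hat_def algebra_simps)
  ultimately show "y (Suc (Suc j)) + b (Suc j) * y (Suc j) + c j * y j = 0" by simp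
qed

text \<open>Both sides satisfy the same recurrence in \<open>j\<close>: on the left, multiplication by \<open>\<lambda>\<close> turns the
  functional of the shifted sequence into that of \<open>s\<close>, which vanishes on \<open>P\<^sub>j\<close> for \<open>j \<ge> 1\<close>.\<close>

lemma shifted_functional_first_kind:
  assumes sys: "monic_orthogonal_system s P"
    and first: "first_kind \<sigma> s b c P" and second: "second_kind s b c Q"
  shows "moment_functional (shifted_seq a s) (P j) = poly (P_hat a P Q j) 0"
proof -
  interpret monic_orthogonal_system s P by (rule sys)
  let ?f = "moment_functional (shifted_seq a s)"
  have rec: "jacobi_recurrence b c (s 0) 0 P" and P_0: "P 0 = 1"
    using first by (auto simp: first_kind_def)
  note y = P_hat_recurrence[OF first second, of a]
  have f_0: "?f (P 0) = a" by (simp add: P_0 shifted_seq_def)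
  show ?thesis
  proof (induction j rule: induct_nat_012)
    case 0
    show ?case using f_0 y(1) by simp
  next
    case 1
    have "?f (pCons 0 (P 0)) = s 0"
      by (simp only: shifted_functional_pCons) (simp add: P_0)
    then have "?f (P 1) + b 0 * ?f (P 0) = s 0"
      unfolding jacobi_recurrence_0[OF rec]
      by (simp add: moment_functional_add moment_functional_smult)
    then show ?case using f_0 y(1,2) by simp
  next
    case (ge2 j)
    have "moment_functional s (P (Suc j)) = 0"
      using orthogonal_lower_degree[of 1 "Suc j"] by simp
    then have "?f (P (Suc (Suc j))) + b (Suc j) * ?f (P (Suc j)) + c j * ?f (P j) = 0"
      using arg_cong[OF jacobi_recurrence_Suc[OF rec, of j], of ?f]
      by (simp add: shifted_functional_pCons moment_functional_add moment_functional_smult)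
    then show ?case using ge2 y(3)[of j] by simp
  qed
qed

lemma normal_index_Suc:
  assumes "infinite (normal_indices s)"
  shows "normal_index s (Suc j) = (LEAST n. n \<in> normal_indices s \<and> normal_index s j < n)"
proof (cases j)
  case 0
  have "n \<in> normal_indices s \<longleftrightarrow> n \<in> normal_indices s \<and> 0 < n" for n
    by (auto simp: normal_indices_def)
  then show ?thesis
    using 0 by (simp add: normal_index_def enumerate_0)
next
  case (Suc i)
  then show ?thesis
    using assms by (simp add: normal_index_def enumerate_Suc'')
qed

theorem proposition4p3:
  fixes F :: "complex \<Rightarrow> complex" and s :: "nat \<Rightarrow> real" and \<sigma> :: "real measure"
    and b c :: "nat \<Rightarrow> real" and P Q :: "nat \<Rightarrow> real poly" and sm1 :: real
    and nn :: "nat \<Rightarrow> nat"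
  assumes "nevanlinna_asymp F s"
    and "\<not> rational_on_upper_half_plane F"
    and "moment_representation \<sigma> F s"
    and "first_kind \<sigma> s b c P"
    and "second_kind s b c Q"
  defines "nn \<equiv> normal_index (shifted_seq sm1 s)"
  shows "infinite (normal_indices (shifted_seq sm1 s)) \<and>
         normal_indices (shifted_seq sm1 s) = {n. n \<ge> 1 \<and> poly (P_hat sm1 P Q (n - 1)) 0 \<noteq> 0} \<and>
         (\<forall>j. index_gap nn j \<in> {1, 2}) \<and>
         (\<exists>u l e. is_matrix_product (jacobi_matrix b c) (U_matrix nn u) (L_matrix nn l e) \<and>
            (\<forall>j\<ge>1. l j = - poly (P_hat sm1 P Q (nn (Suc j) - 1)) 0
                            / poly (P_hat sm1 P Q (nn j - 1)) 0))"
proof -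
  define y where "y = (\<lambda>j. poly (P_hat sm1 P Q j) 0)"
  define S where "S = normal_indices (shifted_seq sm1 s)"
  have s_0: "s 0 \<noteq> 0"
    using total_mass_nonzero assms(1,3) by (auto simp: nevanlinna_asymp_def)
  have c: "c j > 0" for j using assms(4) by (simp add: first_kind_def)
  have sys: "monic_orthogonal_system s P"
    using first_kind_orthogonal_system assms(3,4) s_0 .
  have y_1: "y 1 + b 0 * y 0 = s 0"
    and y_rec: "y (Suc (Suc j)) + b (Suc j) * y (Suc j) + c j * y j = 0" for j
    unfolding y_def using P_hat_recurrence[OF assms(4,5)] by blast+
  have member: "Suc r \<in> S \<longleftrightarrow> y r \<noteq> 0" for r
    using monic_orthogonal_system.shifted_hankel_det_nonzero_iff[OF sys, of r sm1]
      shifted_functional_first_kind[OF sys assms(4,5), of sm1 r]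
    by (simp add: S_def normal_indices_def y_def)
  have S_pos: "n \<in> S \<Longrightarrow> n \<ge> 1" for n by (simp add: S_def normal_indices_def)
  have S_eq: "S = {n. n \<ge> 1 \<and> y (n - 1) \<noteq> 0}"
  proof (rule Set.set_eqI)
    fix n show "n \<in> S \<longleftrightarrow> n \<in> {n. n \<ge> 1 \<and> y (n - 1) \<noteq> 0}"
      using member[of "n - 1"] S_pos[of n] by (cases n) auto
  qed
  have no_two_zeros: "y r \<noteq> 0 \<or> y (Suc r) \<noteq> 0" for r
  proof (induction r)
    case 0
    then show ?case using y_1 s_0 by auto
  next
    case (Suc r)
    then show ?case using y_rec[of r] c[of r] by auto
  qed
  have inf: "infinite S"
    unfolding infinite_nat_iff_unbounded
  proof
    fix m show "\<exists>n>m. n \<in> S"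
      using no_two_zeros[of m] member[of m] member[of "Suc m"] by (metis less_Suc_eq)
  qed
  have nn_Suc: "nn (Suc j) = (LEAST n. n \<in> S \<and> nn j < n)" for j
    using normal_index_Suc inf unfolding S_def nn_def by blast
  have next_in: "nn (Suc j) \<in> S" "nn j < nn (Suc j)" for j
  proof -
    have "\<exists>n. n \<in> S \<and> nn j < n" using inf by (auto simp: infinite_nat_iff_unbounded)
    then have "nn (Suc j) \<in> S \<and> nn j < nn (Suc j)"
      unfolding nn_Suc by (rule LeastI_ex)
    then show "nn (Suc j) \<in> S" "nn j < nn (Suc j)" by auto
  qed
  have next_le: "nn (Suc j) \<le> n" if "n \<in> S" "nn j < n" for j n
    unfolding nn_Suc using that by (intro Least_le) simp
  have gap: "index_gap nn j \<in> {1, 2}" for j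
  proof -
    have "nn (Suc j) \<le> Suc (Suc (nn j))"
      using no_two_zeros[of "nn j"] member next_le[of "Suc (nn j)" j] next_le[of "Suc (Suc (nn j))" j]
      by fastforce
    then show ?thesis using next_in(2)[of j] by (auto simp: index_gap_def)
  qed
  interpret block_partition nn
    by unfold_locales (use gap in \<open>auto simp: nn_def normal_index_def\<close>)
  \<comment> \<open>The value \<open>l 0\<close>, where \<open>nn 0 - 1\<close> truncates to \<open>0\<close>, does not occur in \<open>L\<close>.\<close>
  define l where "l = (\<lambda>j. - y (nn (Suc j) - 1) / y (nn j - 1))"
  define e where "e = (\<lambda>j. b (nn j))"
  define u where "u = (\<lambda>j. if index_gap nn j = 2 then c (nn j)
       else if j = 0 then s 0 / y 0 else - c (nn j - 1) * y (nn j - 1) / y (nn j))"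
  have "is_matrix_product (jacobi_matrix b c) (U_matrix nn u) (L_matrix nn l e)"
  proof (rule jacobi_factorization[where y = y and ?s0.0 = "s 0"])
    show "y r \<noteq> 0" if "Suc r = nn (Suc j)" for r j
      using next_in(1)[of j] member[of r] that by simp
    show "y (nn j) = 0" if "Suc (Suc (nn j)) = nn (Suc j)" for j
      using next_le[of "Suc (nn j)" j] member[of "nn j"] that by fastforce
  qed (use y_1 y_rec in \<open>auto simp: l_def e_def u_def\<close>)
  then have "\<exists>u l e. is_matrix_product (jacobi_matrix b c) (U_matrix nn u) (L_matrix nn l e) \<and>
      (\<forall>j\<ge>1. l j = - y (nn (Suc j) - 1) / y (nn j - 1))"
    by (intro exI[of _ u] exI[of _ l] exI[of _ e]) (simp add: l_def)
  then show ?thesis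
    using inf S_eq gap unfolding S_def y_def by blast
qed

end
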